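(* Consider the three-dimensional curvilinear DGSEM semi-discretization of the compressible Euler equations with gravity for the set of conserved variables $(\varrho,\varrho\vec V,X)$, where $X$ represents any conserved variable that closes the system. The non-conservative numerical surface and volume fluxes $\vec g$ preserve the hydrostatic balance prescribed by a constant background temperature $T$ under any coordinate mapping if (i) the non-conservative volume flux is of the form $\vec g^{\varrho\vec V,\mathrm{vol}}=\{\!\{\varrho\}\!\}_{\log}\,[\![\phi]\!]$; (ii) the pressure term is discretized as $\{\!\{p\}\!\}$; and (iii) the free-stream preservation property is satisfied at the discrete level.
   Context: Momentum equation: $\partial_t(\varrho\vec V)+\nabla\cdot(\varrho\vec V\otimes\vec V)+\nabla p+\varrho\nabla\phi=0$, with a time-independent geopotential $\phi(x,y,z)$ which is a function of physical space evaluated at the nodes, so coincident nodes of neighbouring elements carry the same value of $\phi$. The isothermal hydrostatic state is $\vec V=0$, $p=p_0e^{-\phi/(RT)}$, $\varrho=\frac{p_0}{RT}e^{-\phi/(RT)}$ with constants $p_0,R,T>0$. For an ordered pair of nodes with values $a_-$ (first), $a_+$ (second): $\{\!\{a\}\!\}=(a_-+a_+)/2$, $[\![a]\!]=a_+-a_-$, $\{\!\{a\}\!\}_{\log}=[\![a]\!]/[\![\log a]\!]$ for positive values (equal to $a$ if $a_\pm=a$). The two-point volume non-conservative term in Cartesian direction $d$ has momentum component $c$ equal to $\delta_{cd}\{\!\{\varrho\}\!\}_{\log}[\![\phi]\!]$; the surface non-conservative flux is of the form (density mean)$\times[\![\phi]\!]$, hence vanishes where $\phi$ is continuous. "The pressure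 term is discretized as $\{\!\{p\}\!\}$" means that for states at rest the two-point volume and surface momentum fluxes are $f^d_{\varrho v_c}=\delta_{cd}\{\!\{p\}\!\}$. DGSEM: on each hexahedral element mapped from $[-1,1]^3$, with tensor-product Lobatto–Gauss–Legendre nodes $(i,j,k)\in\{0,\dots,N\}^3$, 1D weights $\omega_i$, $\omega_{ij}=\omega_i\omega_j$, $\omega_{ijk}=\omega_i\omega_j\omega_k$, Lagrange derivative matrix $D_{ij}=l_j'(\xi_i)$, $Q_{ij}=\omega_iD_{ij}$ ($\sum_jQ_{ij}=0$), mapping Jacobian $J_{ijk}>0$ and contravariant metric vectors $J\vec a^1,J\vec a^2,J\vec a^3\in\mathbb R^3$ at the nodes, the scheme is $J_{ijk}\omega_{ijk}\dot u_{ijk}=\mathcal F^1_{ijk}+\mathcal F^2_{ijk}+\mathcal F^3_{ijk}$ with $$\mathcal F^1_{ijk}=\omega_{jk}\Big(-2\sum_mQ_{im}\tilde f^{1,\mathrm{vol}}_{(i,m)jk}-\sum_mQ_{im}\tilde g^{1,\mathrm{vol}}_{(i,m)jk}-\delta_{i0}[\overset{\leftrightarrow}f\cdot J\vec a^1]_{0jk}+\delta_{iN}[\overset{\leftrightarrow}f\cdot J\vec a^1]_{Njk}+\delta_{i0}[\tilde f^*_{(0,L)jk}+\tfrac12\tilde g^*_{(0,L)jk}]-\delta_{iN}[\tilde f^*_{(N,R)jk}+\tfrac12\tilde g^*_{(N,R)jk}]\Big),$$ and $\mathcal F^2,\mathcal F^3$ defined analogously in the second index (with $\omega_{ik}$,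 $J\vec a^2$) and third index (with $\omega_{ij}$, $J\vec a^3$). Here $\overset{\leftrightarrow}f=(f^1,f^2,f^3)$, $\overset{\leftrightarrow}f\cdot\vec a=\sum_da_df^d$ (likewise for $g$), $[\overset{\leftrightarrow}f\cdot J\vec a^1]$ uses the exact fluxes, $\tilde f^{1,\mathrm{vol}}_{(i,m)jk}=\overset{\leftrightarrow}f{}^{\mathrm{vol}}(u_{ijk},u_{mjk})\cdot\{\!\{J\vec a^1\}\!\}_{(i,m)jk}$, $\tilde g^{1,\mathrm{vol}}_{(i,m)jk}=\overset{\leftrightarrow}g{}^{\mathrm{vol}}(u_{ijk},u_{mjk})\cdot\{\!\{J\vec a^1\}\!\}_{(i,m)jk}$ (jump $\phi_{mjk}-\phi_{ijk}$), the starred surface quantities are defined by the same formulas with $f^*,g^*$, and $L$, $R$ denote the coincident node of the neighbouring element at the lower/upper face. The mesh is conforming, neighbouring elements have aligned reference directions and the metric vectors $J\vec a^m$ normal to a shared face agree from both sides. Free-stream preservation at the discrete level means the discrete metric identities $\sum_m\big(D_{im}(J\vec a^1)_{mjk}+D_{jm}(J\vec a^2)_{imk}+D_{km}(J\vec a^3)_{ijm}\big)=0$ for all $i,j,k$ (equivalently, since $\sum_mD_{im}=0$, $\sum_m2\big(D_{im}\{\!\{J\vec a^1\}\!\}_{(i,m)jk}+D_{jm}\{\!\{J\vec a^2\}\!\}_{i(j,m)k}+D_{km}\{\!\{J\vec a^3\}\!\}_{ij(k,m)}\big)=0$). Preserving the hydrostatic balance means that, for nodal data equal to the isothermal hydrostatic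 state, the right-hand side of the momentum equation vanishes at every node of every element. *)

theory Defs
  imports "HOL-Analysis.Analysis" "HOL-Computational_Algebra.Polynomial"
begin

text \<open>Rodrigues' formula.\<close>
definition legendre :: "nat \<Rightarrow> real poly" where
  "legendre n = smult (1 / (2 ^ n * fact n)) ((pderiv ^^ n) ([:-1, 0, 1:] ^ n))"

definition lgl_nodes :: "nat \<Rightarrow> (nat \<Rightarrow> real) \<Rightarrow> bool" where
  "lgl_nodes N \<xi> \<longleftrightarrow> N \<ge> 1 \<and> strict_mono_on {0..N} \<xi> \<and> \<xi> 0 = -1 \<and> \<xi> N = 1 \<and>
     (\<forall>i. 0 < i \<and> i < N \<longrightarrow> poly (pderiv (legendre N)) (\<xi> i) = 0)"

definition lagrange_basis :: "nat \<Rightarrow> (nat \<Rightarrow> real) \<Rightarrow> nat \<Rightarrow> real poly" where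
  "lagrange_basis N \<xi> j = (\<Prod>m\<in>{0..N} - {j}. smult (1 / (\<xi> j - \<xi> m)) [:- \<xi> m, 1:])"

text \<open>The LGL rule is interpolatory, so its weights are the integrals of the Lagrange basis.\<close>
definition quad_weight :: "nat \<Rightarrow> (nat \<Rightarrow> real) \<Rightarrow> nat \<Rightarrow> real" where
  "quad_weight N \<xi> i = integral {-1..1} (poly (lagrange_basis N \<xi> i))"

definition diff_matrix :: "nat \<Rightarrow> (nat \<Rightarrow> real) \<Rightarrow> nat \<Rightarrow> nat \<Rightarrow> real" where
  "diff_matrix N \<xi> i j = poly (pderiv (lagrange_basis N \<xi> j)) (\<xi> i)"

definition Q_matrix :: "nat \<Rightarrow> (nat \<Rightarrow> real) \<Rightarrow> nat \<Rightarrow> nat \<Rightarrow> real" where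
  "Q_matrix N \<xi> i j = quad_weight N \<xi> i * diff_matrix N \<xi> i j"

text \<open>Conserved variables \<open>(\<rho>, \<rho>V, X)\<close>; the same type holds fluxes and right-hand sides.\<close>
type_synonym state = "real \<times> (real^3) \<times> real"

abbreviation density :: "state \<Rightarrow> real" where "density u \<equiv> fst u"
abbreviation momentum :: "state \<Rightarrow> real^3" where "momentum u \<equiv> fst (snd u)"

text \<open>The state at a node together with the value of the geopotential there.  Fluxes and
  equation of state may use the latter, e.g. when \<open>X\<close> is a total energy including \<open>\<rho>\<phi>\<close>.\<close>
type_synonym point = "state \<times> real"

abbreviation rho :: "point \<Rightarrow> real" where "rho a \<equiv> density (fst a)"
abbreviation mom :: "point \<Rightarrow> real^3" where "mom a \<equiv> momentum (fst a)"
abbreviation geop :: "point \<Rightarrow> real" where "geop a \<equiv> snd a"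

text \<open>A flux assigns a vector of conserved quantities to each Cartesian direction.\<close>
type_synonym flux = "3 \<Rightarrow> state"

definition contract :: "flux \<Rightarrow> real^3 \<Rightarrow> state" where
  "contract f a = (\<Sum>d\<in>UNIV. (a $ d) *\<^sub>R f d)"

definition avg :: "'a::real_vector \<Rightarrow> 'a \<Rightarrow> 'a" where
  "avg a b = (1/2) *\<^sub>R (a + b)"

definition jump :: "real \<Rightarrow> real \<Rightarrow> real" where
  "jump a b = b - a"

definition log_mean :: "real \<Rightarrow> real \<Rightarrow> real" where
  "log_mean a b = (if a = b then a else jump a b / jump (ln a) (ln b))"

definition is_mean :: "(real \<Rightarrow> real \<Rightarrow> real) \<Rightarrow> bool" where
  "is_mean m \<longleftrightarrow> (\<forall>a>0. \<forall>b>0. min a b \<le> m a b \<and> m a b \<le> max a b)"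

text \<open>Euler flux.  The pressure \<open>p\<close> is given by the equation of state; the flux \<open>fX\<close> of the
  closing variable is left arbitrary.\<close>
definition euler_flux :: "(point \<Rightarrow> real) \<Rightarrow> (point \<Rightarrow> 3 \<Rightarrow> real) \<Rightarrow> point \<Rightarrow> flux" where
  "euler_flux p fX a d =
     (mom a $ d, (mom a $ d / rho a) *\<^sub>R mom a + p a *\<^sub>R axis d 1, fX a d)"

record two_point_fluxes =
  f_vol :: "point \<Rightarrow> point \<Rightarrow> flux"
  g_vol :: "point \<Rightarrow> point \<Rightarrow> flux"
  f_surf :: "point \<Rightarrow> point \<Rightarrow> flux"
  g_surf :: "point \<Rightarrow> point \<Rightarrow> flux"

text \<open>Component \<open>c\<close> of \<open>axis d 1\<close> is the Kronecker delta.\<close>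

definition nonconservative_form ::
  "(real \<Rightarrow> real \<Rightarrow> real) \<Rightarrow> (point \<Rightarrow> point \<Rightarrow> flux) \<Rightarrow> bool" where
  "nonconservative_form m g \<longleftrightarrow> (\<forall>a b d. rho a > 0 \<and> rho b > 0 \<longrightarrow>
     momentum (g a b d) = (m (rho a) (rho b) * jump (geop a) (geop b)) *\<^sub>R axis d 1)"

definition mean_pressure_form ::
  "(point \<Rightarrow> real) \<Rightarrow> (point \<Rightarrow> point \<Rightarrow> flux) \<Rightarrow> bool" where
  "mean_pressure_form p f \<longleftrightarrow>
     (\<forall>a b d. rho a > 0 \<and> rho b > 0 \<and> mom a = 0 \<and> mom b = 0 \<longrightarrow>
        momentum (f a b d) = avg (p a) (p b) *\<^sub>R axis d 1)"

text \<open>The node \<open>(i, j, k)\<close> is the function with values \<open>i, j, k\<close> at the directions \<open>1, 2, 3\<close>;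
  \<open>\<nu>(d := m)\<close> replaces its \<open>d\<close>-th index.\<close>
type_synonym node = "3 \<Rightarrow> nat"

definition nodes :: "nat \<Rightarrow> node set" where
  "nodes N = {\<nu>. \<forall>d. \<nu> d \<le> N}"

text \<open>\<open>nbr_lo E e d\<close> and \<open>nbr_hi E e d\<close> are the neighbours across the lower and upper face of \<open>e\<close> in
  reference direction \<open>d\<close>.  They need not belong to \<open>elems\<close>, so that elements next to the boundary
  may have exterior elements as neighbours.
  \<open>Ja E e \<nu> d\<close> is the contravariant vector \<open>J a\<^sup>d\<close> at a node.  The nodal metric terms are data of
  the discretization: in practice they are discrete approximations, not exact derivatives of
  \<open>chart\<close>, and only their discrete properties matter.\<close>
record 'e mesh =
  elems :: "'e set"
  nbr_lo :: "'e \<Rightarrow> 3 \<Rightarrow> 'e"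
  nbr_hi :: "'e \<Rightarrow> 3 \<Rightarrow> 'e"
  chart :: "'e \<Rightarrow> real^3 \<Rightarrow> real^3"
  Jac :: "'e \<Rightarrow> node \<Rightarrow> real"
  Ja :: "'e \<Rightarrow> node \<Rightarrow> 3 \<Rightarrow> real^3"

definition node_pos :: "(nat \<Rightarrow> real) \<Rightarrow> 'e mesh \<Rightarrow> 'e \<Rightarrow> node \<Rightarrow> real^3" where
  "node_pos \<xi> E e \<nu> = chart E e (\<chi> d. \<xi> (\<nu> d))"

definition all_elems :: "'e mesh \<Rightarrow> 'e set" where
  "all_elems E = elems E \<union> {nbr_lo E e d | e d. e \<in> elems E} \<union> {nbr_hi E e d | e d. e \<in> elems E}"

text \<open>Conforming, with aligned reference directions: nodes on a shared face coincide in physical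
  space, and the metric vectors normal to the face agree from both sides.\<close>
definition conforming_mesh :: "nat \<Rightarrow> (nat \<Rightarrow> real) \<Rightarrow> 'e mesh \<Rightarrow> bool" where
  "conforming_mesh N \<xi> E \<longleftrightarrow>
     (\<forall>e\<in>all_elems E. \<forall>\<nu>\<in>nodes N. Jac E e \<nu> > 0) \<and>
     (\<forall>e\<in>elems E. \<forall>\<nu>\<in>nodes N. \<forall>d.
        (\<nu> d = 0 \<longrightarrow> node_pos \<xi> E (nbr_lo E e d) (\<nu>(d := N)) = node_pos \<xi> E e \<nu> \<and>
                    Ja E (nbr_lo E e d) (\<nu>(d := N)) d = Ja E e \<nu> d) \<and>
        (\<nu> d = N \<longrightarrow> node_pos \<xi> E (nbr_hi E e d) (\<nu>(d := 0)) = node_pos \<xi> E e \<nu> \<and>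
                    Ja E (nbr_hi E e d) (\<nu>(d := 0)) d = Ja E e \<nu> d))"

definition discrete_metric_identities :: "nat \<Rightarrow> (nat \<Rightarrow> real) \<Rightarrow> 'e mesh \<Rightarrow> bool" where
  "discrete_metric_identities N \<xi> E \<longleftrightarrow> (\<forall>e\<in>elems E. \<forall>\<nu>\<in>nodes N.
     (\<Sum>m\<le>N. \<Sum>d\<in>UNIV. diff_matrix N \<xi> (\<nu> d) m *\<^sub>R Ja E e (\<nu>(d := m)) d) = 0)"

definition point_at ::
  "(nat \<Rightarrow> real) \<Rightarrow> 'e mesh \<Rightarrow> (real^3 \<Rightarrow> real) \<Rightarrow> ('e \<Rightarrow> node \<Rightarrow> state) \<Rightarrow> 'e \<Rightarrow> node \<Rightarrow> point" where
  "point_at \<xi> E \<phi> u e \<nu> = (u e \<nu>, \<phi> (node_pos \<xi> E e \<nu>))"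

text \<open>Contravariant two-point flux in reference direction \<open>d\<close> between node \<open>\<nu>\<close> of \<open>e\<close> (first) and
  node \<open>\<nu>'\<close> of \<open>e'\<close> (second); volume terms have \<open>e' = e\<close>.\<close>
definition contravariant_flux ::
  "'e mesh \<Rightarrow> ('e \<Rightarrow> node \<Rightarrow> point) \<Rightarrow> (point \<Rightarrow> point \<Rightarrow> flux) \<Rightarrow> 3 \<Rightarrow>
     'e \<Rightarrow> node \<Rightarrow> 'e \<Rightarrow> node \<Rightarrow> state" where
  "contravariant_flux E U h d e \<nu> e' \<nu>' =
     contract (h (U e \<nu>) (U e' \<nu>')) (avg (Ja E e \<nu> d) (Ja E e' \<nu>' d))"

definition dgsem_direction ::
  "nat \<Rightarrow> (nat \<Rightarrow> real) \<Rightarrow> 'e mesh \<Rightarrow> two_point_fluxes \<Rightarrow> (point \<Rightarrow> flux) \<Rightarrow>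
     ('e \<Rightarrow> node \<Rightarrow> point) \<Rightarrow> 'e \<Rightarrow> node \<Rightarrow> 3 \<Rightarrow> state" where
  "dgsem_direction N \<xi> E F f U e \<nu> d =
     (let i = \<nu> d;
          tf = contravariant_flux E U (f_vol F) d e \<nu> e;
          tg = contravariant_flux E U (g_vol F) d e \<nu> e;
          tfs = contravariant_flux E U (f_surf F) d e \<nu>;
          tgs = contravariant_flux E U (g_surf F) d e \<nu>;
          L = nbr_lo E e d; \<nu>L = \<nu>(d := N);
          R = nbr_hi E e d; \<nu>R = \<nu>(d := 0)
      in (\<Prod>d'\<in>UNIV - {d}. quad_weight N \<xi> (\<nu> d')) *\<^sub>R
         (- 2 *\<^sub>R (\<Sum>m\<le>N. Q_matrix N \<xi> i m *\<^sub>R tf (\<nu>(d := m)))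
          - (\<Sum>m\<le>N. Q_matrix N \<xi> i m *\<^sub>R tg (\<nu>(d := m)))
          - of_bool (i = 0) *\<^sub>R contract (f (U e \<nu>)) (Ja E e \<nu> d)
          + of_bool (i = N) *\<^sub>R contract (f (U e \<nu>)) (Ja E e \<nu> d)
          + of_bool (i = 0) *\<^sub>R (tfs L \<nu>L + (1/2) *\<^sub>R tgs L \<nu>L)
          - of_bool (i = N) *\<^sub>R (tfs R \<nu>R + (1/2) *\<^sub>R tgs R \<nu>R)))"

text \<open>The scheme reads \<open>J \<omega>\<^sub>i \<omega>\<^sub>j \<omega>\<^sub>k u' = dgsem_rhs\<close> at each node, with \<open>J\<close> the nodal value of \<open>Jac\<close>
  and \<open>u'\<close> the time derivative of \<open>u\<close>.\<close>
definition dgsem_rhs ::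
  "nat \<Rightarrow> (nat \<Rightarrow> real) \<Rightarrow> 'e mesh \<Rightarrow> two_point_fluxes \<Rightarrow> (point \<Rightarrow> flux) \<Rightarrow>
     ('e \<Rightarrow> node \<Rightarrow> point) \<Rightarrow> 'e \<Rightarrow> node \<Rightarrow> state" where
  "dgsem_rhs N \<xi> E F f U e \<nu> = (\<Sum>d\<in>UNIV. dgsem_direction N \<xi> E F f U e \<nu> d)"

definition isothermal_hydrostatic ::
  "real \<Rightarrow> real \<Rightarrow> real \<Rightarrow> (point \<Rightarrow> real) \<Rightarrow> point \<Rightarrow> bool" where
  "isothermal_hydrostatic p0 R T p a \<longleftrightarrow>
     mom a = 0 \<and>
     p a = p0 * exp (- geop a / (R * T)) \<and>
     rho a = p0 / (R * T) * exp (- geop a / (R * T))"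

definition preserves_hydrostatic_balance ::
  "real \<Rightarrow> real \<Rightarrow> real \<Rightarrow> (point \<Rightarrow> real) \<Rightarrow> (point \<Rightarrow> 3 \<Rightarrow> real) \<Rightarrow> (real^3 \<Rightarrow> real) \<Rightarrow>
     nat \<Rightarrow> (nat \<Rightarrow> real) \<Rightarrow> 'e mesh \<Rightarrow> two_point_fluxes \<Rightarrow> bool" where
  "preserves_hydrostatic_balance p0 R T p fX \<phi> N \<xi> E F \<longleftrightarrow>
     (\<forall>u. (\<forall>e\<in>all_elems E. \<forall>\<nu>\<in>nodes N. isothermal_hydrostatic p0 R T p (point_at \<xi> E \<phi> u e \<nu>)) \<longrightarrow>
        (\<forall>e\<in>elems E. \<forall>\<nu>\<in>nodes N.
           momentum (dgsem_rhs N \<xi> E F (euler_flux p fX) (point_at \<xi> E \<phi> u) e \<nu>) = 0))"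

end

theory Submission
  imports Defs
begin

text \<open>
  In the isothermal hydrostatic state \<open>p = R T \<rho>\<close> and \<open>ln \<rho>\<close> is affine in \<open>\<phi>\<close> with slope
  \<open>- 1 / (R T)\<close>.  Hence the logarithmic mean of the density turns the jump of the geopotential into a
  jump of the pressure (lemma \<open>log_mean_hydrostatic\<close>): the product of
  \<open>log_mean \<rho>\<^sub>1 \<rho>\<^sub>2\<close> and \<open>\<phi>\<^sub>2 - \<phi>\<^sub>1\<close> is \<open>p\<^sub>1 - p\<^sub>2\<close>.  Twice the mean pressure plus this term is
  \<open>2 p\<^sub>1\<close>, so the combined two-point volume flux between a node and any other node of the same line
  contains only the pressure at the former.

  This pressure factors out of the volume sums, and what is left of them is a sum of averaged
  metric vectors against \<open>Q\<close>.  The rows of the derivative matrix add up to zero because the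
  Lagrange basis is a partition of unity, so the averages reduce to the metric vectors themselves.

  At a face the two coincident nodes carry the same geopotential, hence the same pressure; the
  surface non-conservative flux vanishes, and the surface pressure flux cancels the flux of the
  interior state.  After summation over the three reference directions, the right-hand side is the
  negative nodal pressure times the quadrature weight of the node times the sum that vanishes by the
  discrete metric identities.
\<close>

section \<open>Row sums of the derivative matrix\<close>

lemma poly_lagrange_basis_node:
  assumes "inj_on \<xi> {0..N}" "i \<le> N" "j \<le> N"
  shows "poly (lagrange_basis N \<xi> j) (\<xi> i) = of_bool (i = j)"
proof (cases "i = j")
  case True
  have "poly (smult (1 / (\<xi> j - \<xi> m)) [:- \<xi> m, 1:]) (\<xi> j) = 1" if "m \<in> {0..N} - {j}" for m
  proof -
    have "\<xi> j \<noteq> \<xi> m"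
      using assms that by (auto simp: inj_on_eq_iff)
    then show ?thesis
      by (simp add: divide_simps)
  qed
  then show ?thesis
    using True by (simp add: lagrange_basis_def poly_prod del: poly_smult)
next
  case False
  then show ?thesis
    using assms by (auto simp: lagrange_basis_def poly_prod)
qed

lemma degree_lagrange_basis_le:
  assumes "j \<le> N"
  shows "degree (lagrange_basis N \<xi> j) \<le> N"
proof -
  have "degree (lagrange_basis N \<xi> j) \<le>
      (\<Sum>m\<in>{0..N} - {j}. degree (smult (1 / (\<xi> j - \<xi> m)) [:- \<xi> m, 1:]))"
    unfolding lagrange_basis_def by (rule degree_prod_sum_le[unfolded o_def]) simp
  also have "\<dots> \<le> (\<Sum>m\<in>{0..N} - {j}. 1)"
    by (intro sum_mono) (auto intro: order.trans[OF degree_smult_le])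
  also have "\<dots> = N"
    using assms by simp
  finally show ?thesis .
qed

text \<open>The Lagrange basis is a partition of unity: the difference from \<open>1\<close> has degree at most \<open>N\<close>
  but vanishes at \<open>N + 1\<close> nodes.\<close>
lemma sum_lagrange_basis:
  assumes "inj_on \<xi> {0..N}"
  shows "(\<Sum>j\<le>N. lagrange_basis N \<xi> j) = 1"
proof (rule ccontr)
  let ?P = "(\<Sum>j\<le>N. lagrange_basis N \<xi> j) - 1"
  assume "(\<Sum>j\<le>N. lagrange_basis N \<xi> j) \<noteq> 1"
  then have nz: "?P \<noteq> 0" by simp
  have "poly ?P (\<xi> i) = 0" if "i \<le> N" for i
    using that by (simp add: poly_sum poly_lagrange_basis_node[OF assms])
  then have "\<xi> ` {0..N} \<subseteq> {x. poly ?P x = 0}" by auto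
  then have "card (\<xi> ` {0..N}) \<le> card {x. poly ?P x = 0}"
    by (intro card_mono poly_roots_finite[OF nz])
  also have "\<dots> \<le> degree ?P"
    by (rule card_poly_roots_bound[OF nz])
  also have "\<dots> \<le> N"
    by (intro degree_diff_le degree_sum_le) (auto simp: degree_lagrange_basis_le)
  finally show False
    using card_image[OF assms] by simp
qed

lemma sum_diff_matrix_row:
  assumes "inj_on \<xi> {0..N}"
  shows "(\<Sum>m\<le>N. diff_matrix N \<xi> i m) = 0"
proof -
  have "(\<Sum>m\<le>N. diff_matrix N \<xi> i m) = poly (pderiv (\<Sum>m\<le>N. lagrange_basis N \<xi> m)) (\<xi> i)"
    by (simp add: diff_matrix_def poly_sum higher_pderiv_sum[of 1, simplified])
  then show ?thesis
    by (simp add: sum_lagrange_basis[OF assms])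
qed

section \<open>Two-point fluxes in the hydrostatic state\<close>

lemma momentum_sum: "momentum (\<Sum>x\<in>A. h x) = (\<Sum>x\<in>A. momentum (h x))"
  by (simp add: fst_sum snd_sum)

text \<open>A flux whose momentum part is a multiple of the identity tensor contracts to that multiple
  of the metric vector.\<close>
lemma momentum_contract_isotropic:
  assumes "\<And>d. momentum (h d) = c *\<^sub>R axis d 1"
  shows "momentum (contract h a) = c *\<^sub>R a"
proof -
  have "momentum (contract h a) = (\<Sum>d\<in>UNIV. (a $ d) *\<^sub>R c *\<^sub>R axis d 1)"
    by (simp add: contract_def momentum_sum assms)
  also have "\<dots> = c *\<^sub>R a"
    by (simp add: vec_eq_iff axis_def if_distrib[of "\<lambda>x. _ * x"] mult.commute cong: if_cong)
  finally show ?thesis .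
qed

lemma isothermal_hydrostatic_density_pos:
  assumes "p0 > 0" "R > 0" "T > 0" "isothermal_hydrostatic p0 R T p a"
  shows "rho a > 0"
  using assms by (simp add: isothermal_hydrostatic_def)

lemma isothermal_hydrostatic_pressure_cong:
  assumes "isothermal_hydrostatic p0 R T p a" "isothermal_hydrostatic p0 R T p b"
    and "geop a = geop b"
  shows "p a = p b"
  using assms by (simp add: isothermal_hydrostatic_def)

text \<open>With the logarithmic mean of the density, the hydrostatic balance between pressure gradient
  and gravity holds exactly for the jumps between two nodes.\<close>
lemma log_mean_hydrostatic:
  assumes const: "p0 > 0" "R > 0" "T > 0"
    and a: "isothermal_hydrostatic p0 R T p a" and b: "isothermal_hydrostatic p0 R T p b"
  shows "log_mean (rho a) (rho b) * jump (geop a) (geop b) = - jump (p a) (p b)"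
proof -
  have RT: "R * T > 0" using const by simp
  have p: "p x = R * T * rho x" and ln: "ln (rho x) = ln (p0 / (R * T)) - geop x / (R * T)"
    if "isothermal_hydrostatic p0 R T p x" for x
  proof -
    show "p x = R * T * rho x"
      using that const by (simp add: isothermal_hydrostatic_def)
    have "rho x = p0 / (R * T) * exp (- geop x / (R * T))"
      using that by (simp add: isothermal_hydrostatic_def)
    moreover have "p0 / (R * T) > 0"
      using RT const by simp
    ultimately show "ln (rho x) = ln (p0 / (R * T)) - geop x / (R * T)"
      by (simp only: ln_mult_pos exp_gt_zero ln_exp)
  qed
  have jump_ln: "jump (ln (rho a)) (ln (rho b)) = - jump (geop a) (geop b) / (R * T)"
    using RT by (simp add: ln[OF a] ln[OF b] jump_def diff_divide_distrib)
  show ?thesis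
  proof (cases "rho a = rho b")
    case True
    then have "jump (geop a) (geop b) = 0"
      using jump_ln const by (simp add: jump_def)
    then show ?thesis
      using True by (simp add: p[OF a] p[OF b] jump_def)
  next
    case False
    have "rho a > 0" "rho b > 0"
      using isothermal_hydrostatic_density_pos[OF const] a b by blast+
    then have "jump (ln (rho a)) (ln (rho b)) \<noteq> 0"
      using False by (simp add: jump_def)
    then have "jump (geop a) (geop b) \<noteq> 0"
      using jump_ln by auto
    then show ?thesis
      using False RT
      by (simp add: log_mean_def jump_ln p[OF a] p[OF b]) (simp add: jump_def algebra_simps)
  qed
qed

section \<open>Hydrostatic balance of the scheme\<close>

text \<open>The momentum right-hand side in one reference direction, for a line of nodes in hydrostatic
  balance: only the nodal pressure, weight and derivative of the metric vectors remain.  The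
  assumptions \<open>lo\<close> and \<open>hi\<close> say that the coincident node across a face carries a hydrostatic state
  with the same geopotential and the same normal metric vector.\<close>
lemma momentum_dgsem_direction_hydrostatic:
  assumes const: "p0 > 0" "R > 0" "T > 0"
    and inj: "inj_on \<xi> {0..N}"
    and surf: "nonconservative_form surf_mean (g_surf F)"
    and vol: "nonconservative_form log_mean (g_vol F)"
    and pf: "mean_pressure_form p (f_vol F)" "mean_pressure_form p (f_surf F)"
    and node: "\<nu> d \<le> N"
    and hyd: "\<And>m. m \<le> N \<Longrightarrow> isothermal_hydrostatic p0 R T p (U e (\<nu>(d := m)))"
    and lo: "\<nu> d = 0 \<Longrightarrow> isothermal_hydrostatic p0 R T p (U (nbr_lo E e d) (\<nu>(d := N))) \<and>
        geop (U (nbr_lo E e d) (\<nu>(d := N))) = geop (U e \<nu>) \<and>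
        Ja E (nbr_lo E e d) (\<nu>(d := N)) d = Ja E e \<nu> d"
    and hi: "\<nu> d = N \<Longrightarrow> isothermal_hydrostatic p0 R T p (U (nbr_hi E e d) (\<nu>(d := 0))) \<and>
        geop (U (nbr_hi E e d) (\<nu>(d := 0))) = geop (U e \<nu>) \<and>
        Ja E (nbr_hi E e d) (\<nu>(d := 0)) d = Ja E e \<nu> d"
  shows "momentum (dgsem_direction N \<xi> E F (euler_flux p fX) U e \<nu> d) =
    - (p (U e \<nu>) * (\<Prod>d'\<in>UNIV. quad_weight N \<xi> (\<nu> d'))) *\<^sub>R
      (\<Sum>m\<le>N. diff_matrix N \<xi> (\<nu> d) m *\<^sub>R Ja E e (\<nu>(d := m)) d)"
proof -
  let ?a = "U e \<nu>"
  let ?n = "Ja E e \<nu> d"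
  have a: "isothermal_hydrostatic p0 R T p ?a"
    using hyd[OF node] by simp
  note pos = isothermal_hydrostatic_density_pos[OF const]
  have rest: "mom b = 0" if "isothermal_hydrostatic p0 R T p b" for b
    using that by (simp add: isothermal_hydrostatic_def)
  have exact: "momentum (contract (euler_flux p fX ?a) ?n) = p ?a *\<^sub>R ?n"
    by (rule momentum_contract_isotropic) (simp add: euler_flux_def rest[OF a])
  have surface:
    "momentum (contravariant_flux E U (f_surf F) d e \<nu> e' \<nu>') = p ?a *\<^sub>R ?n"
    "momentum (contravariant_flux E U (g_surf F) d e \<nu> e' \<nu>') = 0"
    if b: "isothermal_hydrostatic p0 R T p (U e' \<nu>') \<and>
      geop (U e' \<nu>') = geop ?a \<and> Ja E e' \<nu>' d = ?n" for e' \<nu>'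
  proof -
    have eq: "p (U e' \<nu>') = p ?a"
      using b a isothermal_hydrostatic_pressure_cong by blast
    have mean: "avg x x = x" for x :: "'x::real_vector"
      by (simp add: avg_def flip: scaleR_2)
    have f: "momentum (f_surf F ?a (U e' \<nu>') c) = p ?a *\<^sub>R axis c 1" for c
    proof -
      have "momentum (f_surf F ?a (U e' \<nu>') c) = avg (p ?a) (p (U e' \<nu>')) *\<^sub>R axis c 1"
        using pf(2) pos[OF a] rest[OF a] pos[OF b[THEN conjunct1]] rest[OF b[THEN conjunct1]]
        unfolding mean_pressure_form_def by blast
      then show ?thesis
        by (simp only: eq mean)
    qed
    have g: "momentum (g_surf F ?a (U e' \<nu>') c) = 0 *\<^sub>R axis c 1" for c
    proof -
      have "momentum (g_surf F ?a (U e' \<nu>') c) =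
          (surf_mean (rho ?a) (rho (U e' \<nu>')) * jump (geop ?a) (geop (U e' \<nu>'))) *\<^sub>R axis c 1"
        using surf pos[OF a] pos[OF b[THEN conjunct1]]
        unfolding nonconservative_form_def by blast
      then show ?thesis
        using b by (simp add: jump_def)
    qed
    show "momentum (contravariant_flux E U (f_surf F) d e \<nu> e' \<nu>') = p ?a *\<^sub>R ?n"
      using momentum_contract_isotropic[of "f_surf F ?a (U e' \<nu>')", OF f] b
      by (simp add: contravariant_flux_def mean)
    show "momentum (contravariant_flux E U (g_surf F) d e \<nu> e' \<nu>') = 0"
      using momentum_contract_isotropic[of "g_surf F ?a (U e' \<nu>')", OF g]
      by (simp add: contravariant_flux_def)
  qed
  have volume: "2 *\<^sub>R momentum (contravariant_flux E U (f_vol F) d e \<nu> e (\<nu>(d := m))) +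
      momentum (contravariant_flux E U (g_vol F) d e \<nu> e (\<nu>(d := m))) =
      p ?a *\<^sub>R (?n + Ja E e (\<nu>(d := m)) d)" if m: "m \<le> N" for m
  proof -
    let ?b = "U e (\<nu>(d := m))"
    let ?A = "avg ?n (Ja E e (\<nu>(d := m)) d)"
    note b = hyd[OF m]
    have f: "momentum (f_vol F ?a ?b c) = avg (p ?a) (p ?b) *\<^sub>R axis c 1" for c
      using pf(1) pos[OF a] rest[OF a] pos[OF b] rest[OF b]
      unfolding mean_pressure_form_def by blast
    have g: "momentum (g_vol F ?a ?b c) = (- jump (p ?a) (p ?b)) *\<^sub>R axis c 1" for c
      using vol pos[OF a] pos[OF b]
      unfolding nonconservative_form_def log_mean_hydrostatic[OF const a b, symmetric] by blast
    have "2 *\<^sub>R momentum (contravariant_flux E U (f_vol F) d e \<nu> e (\<nu>(d := m))) +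
        momentum (contravariant_flux E U (g_vol F) d e \<nu> e (\<nu>(d := m))) =
        (2 * avg (p ?a) (p ?b) - jump (p ?a) (p ?b)) *\<^sub>R ?A"
      unfolding contravariant_flux_def
      by (simp add: momentum_contract_isotropic[of "f_vol F ?a ?b", OF f]
          momentum_contract_isotropic[of "g_vol F ?a ?b", OF g] scaleR_left_diff_distrib)
    also have "2 * avg (p ?a) (p ?b) - jump (p ?a) (p ?b) = 2 * p ?a"
      by (simp add: avg_def jump_def field_simps)
    also have "(2 * p ?a) *\<^sub>R ?A = p ?a *\<^sub>R (?n + Ja E e (\<nu>(d := m)) d)"
      by (simp add: avg_def)
    finally show ?thesis .
  qed
  let ?w = "quad_weight N \<xi> (\<nu> d)"
  let ?D = "diff_matrix N \<xi> (\<nu> d)"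
  let ?S = "\<Sum>m\<le>N. ?D m *\<^sub>R Ja E e (\<nu>(d := m)) d"
  have "2 *\<^sub>R (\<Sum>m\<le>N. Q_matrix N \<xi> (\<nu> d) m *\<^sub>R
        momentum (contravariant_flux E U (f_vol F) d e \<nu> e (\<nu>(d := m)))) +
      (\<Sum>m\<le>N. Q_matrix N \<xi> (\<nu> d) m *\<^sub>R
        momentum (contravariant_flux E U (g_vol F) d e \<nu> e (\<nu>(d := m)))) =
      (\<Sum>m\<le>N. Q_matrix N \<xi> (\<nu> d) m *\<^sub>R
        (2 *\<^sub>R momentum (contravariant_flux E U (f_vol F) d e \<nu> e (\<nu>(d := m))) +
         momentum (contravariant_flux E U (g_vol F) d e \<nu> e (\<nu>(d := m)))))"
    by (simp add: scaleR_sum_right scaleR_right_distrib sum.distrib mult.commute)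
  also have "\<dots> = (\<Sum>m\<le>N. (p ?a * ?w) *\<^sub>R (?D m *\<^sub>R ?n + ?D m *\<^sub>R Ja E e (\<nu>(d := m)) d))"
    by (intro sum.cong refl) (simp add: volume Q_matrix_def scaleR_right_distrib mult_ac)
  also have "\<dots> = (p ?a * ?w) *\<^sub>R ((\<Sum>m\<le>N. ?D m) *\<^sub>R ?n + ?S)"
    by (simp only: scaleR_sum_right scaleR_sum_left sum.distrib scaleR_right_distrib)
  finally have vol_sum:
    "2 *\<^sub>R (\<Sum>m\<le>N. Q_matrix N \<xi> (\<nu> d) m *\<^sub>R
        momentum (contravariant_flux E U (f_vol F) d e \<nu> e (\<nu>(d := m)))) +
      (\<Sum>m\<le>N. Q_matrix N \<xi> (\<nu> d) m *\<^sub>R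
        momentum (contravariant_flux E U (g_vol F) d e \<nu> e (\<nu>(d := m)))) =
      (p ?a * ?w) *\<^sub>R ?S" (is "2 *\<^sub>R ?f + ?g = _")
    by (simp add: sum_diff_matrix_row[OF inj])
  have lower: "of_bool (\<nu> d = 0) *\<^sub>R
      (momentum (contravariant_flux E U (f_surf F) d e \<nu> (nbr_lo E e d) (\<nu>(d := N))) +
       (1/2) *\<^sub>R momentum (contravariant_flux E U (g_surf F) d e \<nu> (nbr_lo E e d) (\<nu>(d := N))))
      = of_bool (\<nu> d = 0) *\<^sub>R p ?a *\<^sub>R ?n"
    by (cases "\<nu> d = 0") (simp_all add: surface[OF lo])
  have upper: "of_bool (\<nu> d = N) *\<^sub>R
      (momentum (contravariant_flux E U (f_surf F) d e \<nu> (nbr_hi E e d) (\<nu>(d := 0))) +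
       (1/2) *\<^sub>R momentum (contravariant_flux E U (g_surf F) d e \<nu> (nbr_hi E e d) (\<nu>(d := 0))))
      = of_bool (\<nu> d = N) *\<^sub>R p ?a *\<^sub>R ?n"
    by (cases "\<nu> d = N") (simp_all add: surface[OF hi])
  let ?W = "\<Prod>d'\<in>UNIV - {d}. quad_weight N \<xi> (\<nu> d')"
  have "momentum (dgsem_direction N \<xi> E F (euler_flux p fX) U e \<nu> d) =
      ?W *\<^sub>R (- 2 *\<^sub>R ?f - ?g
        - of_bool (\<nu> d = 0) *\<^sub>R p ?a *\<^sub>R ?n + of_bool (\<nu> d = N) *\<^sub>R p ?a *\<^sub>R ?n
        + of_bool (\<nu> d = 0) *\<^sub>R p ?a *\<^sub>R ?n - of_bool (\<nu> d = N) *\<^sub>R p ?a *\<^sub>R ?n)"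
    unfolding dgsem_direction_def Let_def
    by (simp only: fst_scaleR snd_scaleR fst_add snd_add fst_diff snd_diff momentum_sum
        exact lower upper)
  also have "\<dots> = - (?W *\<^sub>R (2 *\<^sub>R ?f + ?g))"
    by (simp flip: scaleR_minus_right)
  also have "\<dots> = - (p ?a * (?w * ?W)) *\<^sub>R ?S"
    by (simp add: vol_sum mult_ac)
  also have "?w * ?W = (\<Prod>d'\<in>UNIV. quad_weight N \<xi> (\<nu> d'))"
    by (simp add: prod.remove[of UNIV d])
  finally show ?thesis .
qed

theorem theorem6p4:
  fixes N :: nat and \<xi> :: "nat \<Rightarrow> real"
    and E :: "'e mesh" and F :: two_point_fluxes
    and p :: "point \<Rightarrow> real" and fX :: "point \<Rightarrow> 3 \<Rightarrow> real"
    and \<phi> :: "real^3 \<Rightarrow> real"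
    and surf_mean :: "real \<Rightarrow> real \<Rightarrow> real"
    and p0 R T :: real
  assumes "lgl_nodes N \<xi>"
    and "conforming_mesh N \<xi> E"
    and "p0 > 0" and "R > 0" and "T > 0"
    and "is_mean surf_mean" and "nonconservative_form surf_mean (g_surf F)"
    and i: "nonconservative_form log_mean (g_vol F)"
    and ii: "mean_pressure_form p (f_vol F)" "mean_pressure_form p (f_surf F)"
    and iii: "discrete_metric_identities N \<xi> E"
  shows "preserves_hydrostatic_balance p0 R T p fX \<phi> N \<xi> E F"
  unfolding preserves_hydrostatic_balance_def
proof (intro allI impI ballI)
  fix u e \<nu>
  let ?U = "point_at \<xi> E \<phi> u"
  assume hyd: "\<forall>e\<in>all_elems E. \<forall>\<nu>\<in>nodes N. isothermal_hydrostatic p0 R T p (?U e \<nu>)"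
    and e: "e \<in> elems E" and \<nu>: "\<nu> \<in> nodes N"
  have inj: "inj_on \<xi> {0..N}"
    using assms(1) strict_mono_on_imp_inj_on by (auto simp: lgl_nodes_def)
  have all: "e \<in> all_elems E" "nbr_lo E e d \<in> all_elems E" "nbr_hi E e d \<in> all_elems E" for d
    using e by (auto simp: all_elems_def)
  have upd: "\<nu>(d := m) \<in> nodes N" if "m \<le> N" for d m
    using \<nu> that by (simp add: nodes_def)
  have face:
    "\<nu> d = 0 \<Longrightarrow> node_pos \<xi> E (nbr_lo E e d) (\<nu>(d := N)) = node_pos \<xi> E e \<nu> \<and>
      Ja E (nbr_lo E e d) (\<nu>(d := N)) d = Ja E e \<nu> d"
    "\<nu> d = N \<Longrightarrow> node_pos \<xi> E (nbr_hi E e d) (\<nu>(d := 0)) = node_pos \<xi> E e \<nu> \<and>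
      Ja E (nbr_hi E e d) (\<nu>(d := 0)) d = Ja E e \<nu> d" for d
    using assms(2) e \<nu> unfolding conforming_mesh_def by blast+
  let ?c = "- (p (?U e \<nu>) * (\<Prod>d'\<in>UNIV. quad_weight N \<xi> (\<nu> d')))"
  have direction: "momentum (dgsem_direction N \<xi> E F (euler_flux p fX) ?U e \<nu> d) =
      ?c *\<^sub>R (\<Sum>m\<le>N. diff_matrix N \<xi> (\<nu> d) m *\<^sub>R Ja E e (\<nu>(d := m)) d)" for d
  proof (rule momentum_dgsem_direction_hydrostatic[OF assms(3-5) inj assms(7) i ii])
    show "\<nu> d \<le> N"
      using \<nu> by (simp add: nodes_def)
    show "isothermal_hydrostatic p0 R T p (?U e (\<nu>(d := m)))" if "m \<le> N" for m
      using hyd all upd[OF that] by blast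
    show "isothermal_hydrostatic p0 R T p (?U (nbr_lo E e d) (\<nu>(d := N))) \<and>
        geop (?U (nbr_lo E e d) (\<nu>(d := N))) = geop (?U e \<nu>) \<and>
        Ja E (nbr_lo E e d) (\<nu>(d := N)) d = Ja E e \<nu> d" if "\<nu> d = 0"
      using face(1)[OF that] hyd[rule_format, OF all(2)[of d] upd[OF order.refl], of d]
      by (simp add: point_at_def)
    show "isothermal_hydrostatic p0 R T p (?U (nbr_hi E e d) (\<nu>(d := 0))) \<and>
        geop (?U (nbr_hi E e d) (\<nu>(d := 0))) = geop (?U e \<nu>) \<and>
        Ja E (nbr_hi E e d) (\<nu>(d := 0)) d = Ja E e \<nu> d" if "\<nu> d = N"
      using face(2)[OF that] hyd[rule_format, OF all(3)[of d] upd[OF le0], of d]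
      by (simp add: point_at_def)
  qed
  have "momentum (dgsem_rhs N \<xi> E F (euler_flux p fX) ?U e \<nu>) =
      ?c *\<^sub>R (\<Sum>d\<in>UNIV. \<Sum>m\<le>N. diff_matrix N \<xi> (\<nu> d) m *\<^sub>R Ja E e (\<nu>(d := m)) d)"
    unfolding dgsem_rhs_def momentum_sum direction by (simp only: scaleR_sum_right)
  also have "(\<Sum>d\<in>UNIV. \<Sum>m\<le>N. diff_matrix N \<xi> (\<nu> d) m *\<^sub>R Ja E e (\<nu>(d := m)) d) = 0"
    using iii e \<nu> by (subst sum.swap) (simp add: discrete_metric_identities_def)
  finally show "momentum (dgsem_rhs N \<xi> E F (euler_flux p fX) ?U e \<nu>) = 0"
    by simp
qed

end
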